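(* Let $b$ be the number of fraction bits and $n$ the dimension of the decision vector. Consider the error dynamics due to arithmetic round-off $$\xi_{i+1}=A\,\xi_i+B\,\upsilon_i,$$ assuming no error reduction from projection, in either of the following two cases. (Fast gradient method) $\xi_i=\begin{bmatrix}\eta_i\\ \eta_{i-1}\end{bmatrix}$, $$A=\begin{bmatrix}(1+\hat\beta)(I-\hat H_n) & -\hat\beta(I-\hat H_n)\\ I & 0\end{bmatrix},\quad B=\begin{bmatrix}I-\hat H_n & I\\ 0&0\end{bmatrix},\quad \upsilon_i=\begin{bmatrix}\epsilon_{y,i-1}\\ \epsilon_{t,i}\end{bmatrix},$$ with $\epsilon_{y,i-1}\in[-2^{-b},2^{-b}]^n$ and $\epsilon_{t,i}\in[-n2^{-b},0]^n$. (ADMM) $\xi_i=\begin{bmatrix}\eta_i\\ \gamma_i\end{bmatrix}$, $$A=\begin{bmatrix}\rho\hat M_{11} & -\bigl(\hat M_{11}-\tfrac1\rho I\bigr)\\ 0&0\end{bmatrix},\quad B=\begin{bmatrix}I&0\\0&I\end{bmatrix},\quad \upsilon_i=\begin{bmatrix}\epsilon_{y,i}\\ \epsilon_{\nu,i}\end{bmatrix},$$ with $\epsilon_{y,i}\in[-n2^{-b},0]^n$ and $\epsilon_{\nu,i}\in[-2^{-b},2^{-b}]^n$. In both cases the initial iterates of the recurrence are given as $\eta_{-1}=\eta_0:=\hat z_0-z_0$. Then the magnitude of any accumulation of round-off errors up to iteration $i$, $\|\eta_i\|=\|\hat z_i-z_i\|$, is upper-bounded by $$\bar\eta_i=\|EA^i\|\,\left\|\begin{bmatrix}\eta_0\\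 \eta_0\end{bmatrix}\right\|+2^{-b}\sqrt{n(1+n^2)}\sum_{k=0}^{i-1}\|EA^{i-1-k}B\|$$ for all $i=0,\ldots,I_{\max}-1$, where $E=\begin{bmatrix}I&0\end{bmatrix}$.
   Context: $\|\cdot\|$ is the Euclidean norm for vectors and the induced norm for matrices; $I$ is the $n\times n$ identity, $E\in\mathbb{R}^{n\times2n}$, and $I_{\max}$ is the number of algorithm iterations. $\hat z_i$ is the iterate computed in fixed-point arithmetic with $b$ fraction bits, $z_i$ the iterate under exact arithmetic, and $\eta_i=\hat z_i-z_i\in\mathbb{R}^n$; for ADMM, $\gamma_i=\hat\nu_i-\nu_i\in\mathbb{R}^n$ is the analogous difference of the multiplier iterates. The vectors $\epsilon$ are the round-off errors of the multiplications in one iteration. For the fast gradient method, $\hat H_n$ is a symmetric $n\times n$ matrix (the scaled fixed-point Hessian) with all eigenvalues in $(0,1]$ and $\hat\beta$ satisfies $1>\hat\beta\ge\bigl(\sqrt{\kappa(\hat H_n)}-1\bigr)\bigl(\sqrt{\kappa(\hat H_n)}+1\bigr)^{-1}\ge0$, with $\kappa$ the condition number. For ADMM, $\rho>0$ is the penalty parameter and $\hat M_{11}$ is the upper-left $n\times n$ block of $\begin{bmatrix}\hat H_A+\rho I&\hat F^T\\ \hat F&0\end{bmatrix}^{-1}$, where $\hat H_A$ is the symmetric positive semidefinite Hessian and $\hat F$, of full row rank, the equality-constraint matrix of the quadratic program being solved (quantization errors are neglected in the analysis).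
   Formalization: For ADMM the initial multiplier error is additionally assumed to satisfy ‖γ_0‖ ≤ ‖η_0‖ (this includes γ_0 = η_0 and γ_0 = 0); with γ_0 unrestricted the bound fails, e.g. at i = 1 with η_0 = 0, zero round-off, zero Hessian and large γ_0 in the range of F^T. *)

theory Defs
  imports "HOL-Analysis.Analysis"
begin

text \<open>The library norm on \<open>real^'n^'m\<close> is entrywise (Frobenius), not the norm induced
  by the Euclidean vector norm; the latter is the operator norm of the associated linear map.\<close>

definition induced_norm :: "real^'n^'m \<Rightarrow> real" where
  "induced_norm M = onorm (\<lambda>x. M *v x)"

text \<open>The type \<open>real^'n^'n\<close> carries no multiplicative structure for \<open>**\<close>, so \<open>(^)\<close> is
  not available for matrix powers.\<close>

primrec mat_power :: "real^'n^'n \<Rightarrow> nat \<Rightarrow> real^'n^'n" where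
  "mat_power M 0 = mat 1"
| "mat_power M (Suc k) = M ** mat_power M k"

text \<open>Block vectors and matrices are indexed by sum types, \<open>Inl\<close> being the first block.\<close>

definition stack :: "real^'n \<Rightarrow> real^'m \<Rightarrow> real^('n::finite + 'm::finite)" where
  "stack x y = (\<chi> i. case i of Inl a \<Rightarrow> x $ a | Inr b \<Rightarrow> y $ b)"

definition block_row :: "real^'n^'k \<Rightarrow> real^'m^'k \<Rightarrow> real^('n::finite + 'm::finite)^'k" where
  "block_row P Q = (\<chi> i. stack (P $ i) (Q $ i))"

definition block_matrix ::
  "real^'n^'k \<Rightarrow> real^'m^'k \<Rightarrow> real^'n^'l \<Rightarrow> real^'m^'l \<Rightarrow> real^('n::finite + 'm::finite)^('k::finite + 'l::finite)" where
  "block_matrix P Q R S =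
    (\<chi> i. case i of Inl a \<Rightarrow> block_row P Q $ a | Inr b \<Rightarrow> block_row R S $ b)"

definition upper_left_block :: "real^('n::finite + 'm::finite)^('k::finite + 'l::finite) \<Rightarrow> real^'n^'k" where
  "upper_left_block M = (\<chi> i j. M $ Inl i $ Inl j)"

definition sel_E :: "real^('n::finite + 'n)^'n" where
  "sel_E = block_row (mat 1) 0"

definition mat_eigenvalue :: "real^'n^'n \<Rightarrow> real \<Rightarrow> bool" where
  "mat_eigenvalue M l \<longleftrightarrow> (\<exists>v. v \<noteq> 0 \<and> M *v v = l *\<^sub>R v)"

definition condition_number :: "real^'n^'n \<Rightarrow> real" where
  "condition_number M = induced_norm M * induced_norm (matrix_inv M)"

definition fgm_parameters :: "real^'n^'n \<Rightarrow> real \<Rightarrow> bool" where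
  "fgm_parameters H \<beta> \<longleftrightarrow>
     transpose H = H \<and>
     (\<forall>l. mat_eigenvalue H l \<longrightarrow> 0 < l \<and> l \<le> 1) \<and>
     1 > \<beta> \<and>
     \<beta> \<ge> (sqrt (condition_number H) - 1) * inverse (sqrt (condition_number H) + 1) \<and>
     (sqrt (condition_number H) - 1) * inverse (sqrt (condition_number H) + 1) \<ge> 0"

definition fgm_A :: "real^'n^'n \<Rightarrow> real \<Rightarrow> real^('n::finite + 'n)^('n + 'n)" where
  "fgm_A H \<beta> = block_matrix
     ((1 + \<beta>) *\<^sub>R (mat 1 - H)) (- (\<beta> *\<^sub>R (mat 1 - H)))
     (mat 1)                     0"

definition fgm_B :: "real^'n^'n \<Rightarrow> real^('n::finite + 'n)^('n + 'n)" where
  "fgm_B H = block_matrix (mat 1 - H) (mat 1) 0 0"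

definition admm_parameters :: "real^'n^'n \<Rightarrow> real^'n^'m \<Rightarrow> real \<Rightarrow> bool" where
  "admm_parameters H F \<rho> \<longleftrightarrow>
     transpose H = H \<and> (\<forall>x. 0 \<le> x \<bullet> (H *v x)) \<and>
     rank F = CARD('m) \<and>
     \<rho> > 0"

definition admm_M11 :: "real^'n^'n \<Rightarrow> real^'n^'m \<Rightarrow> real \<Rightarrow> real^'n^'n" where
  "admm_M11 H F \<rho> =
     upper_left_block (matrix_inv (block_matrix (H + \<rho> *\<^sub>R mat 1) (transpose F) F 0))"

definition admm_A :: "real^'n^'n \<Rightarrow> real^'n^'m \<Rightarrow> real \<Rightarrow> real^('n::finite + 'n)^('n + 'n)" where
  "admm_A H F \<rho> = block_matrix
     (\<rho> *\<^sub>R admm_M11 H F \<rho>) (- (admm_M11 H F \<rho> - (1 / \<rho>) *\<^sub>R mat 1))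
     0                        0"

definition admm_B :: "real^('n::finite + 'n)^('n + 'n)" where
  "admm_B = block_matrix (mat 1) 0 0 (mat 1)"

definition in_box :: "real \<Rightarrow> real \<Rightarrow> real^'n \<Rightarrow> bool" where
  "in_box l u x \<longleftrightarrow> (\<forall>j. x $ j \<in> {l..u})"

end

theory Submission
  imports Defs
begin

text \<open>Unrolling the recurrence gives the discrete variation-of-constants formula: the state at
  step \<open>i\<close> is \<open>A^i\<close> applied to the initial state plus the sum over
  \<open>k < i\<close> of \<open>A^(i-1-k) B\<close> applied to the input
  \<open>\<upsilon> k\<close> (\<open>affine_recurrence_solution\<close>). Applying \<open>E\<close>
  extracts the error \<open>\<eta>\<close>. The triangle inequality and the induced norms then bound
  it once the initial state and the inputs are bounded
  (\<open>affine_recurrence_output_bound\<close>). This one estimate serves both algorithms, which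
  differ in how those two bounds arise. In each case one block of the input lies in a box of radius
  \<open>2^(-b)\<close> and the other in a box of radius \<open>n * 2^(-b)\<close>. Since an
  n-dimensional box of radius \<open>c\<close> lies in the ball of radius \<open>c * sqrt n\<close>,
  the stacked input has norm at most \<open>2^(-b) * sqrt (n * (1 + n^2))\<close>.\<close>

lemma norm_matrix_vector_le: "norm (M *v x) \<le> induced_norm M * norm x"
  unfolding induced_norm_def
  by (rule onorm) (simp add: linear_linear)

lemma norm_stack: "norm (stack x y) = sqrt ((norm x)\<^sup>2 + (norm y)\<^sup>2)"
proof -
  have "(\<Sum>i\<in>UNIV. (norm (stack x y $ i))\<^sup>2)
      = (\<Sum>i\<in>UNIV. (norm (x $ i))\<^sup>2) + (\<Sum>i\<in>UNIV. (norm (y $ i))\<^sup>2)"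
    \<comment> \<open>The index type is a disjoint sum, so the sum over its universe splits into one
      sum per block.\<close>
    by (simp add: stack_def UNIV_Plus_UNIV[symmetric] sum.Plus del: UNIV_Plus_UNIV)
  then show ?thesis
    by (simp add: norm_vec_def L2_set_def sum_nonneg)
qed

lemma stack_nth_Inl: "stack x y $ Inl a = x $ a"
  by (simp add: stack_def)

lemma stack_nth_Inr: "stack x y $ Inr b = y $ b"
  by (simp add: stack_def)

lemma sel_E_stack: "sel_E *v stack x y = x"
proof (rule vec_eq_iff[THEN iffD2, rule_format])
  fix i
  have "(sel_E *v stack x y) $ i = (\<Sum>j\<in>UNIV. mat 1 $ i $ j * x $ j)"
    by (simp add: matrix_vector_mult_def sel_E_def block_row_def stack_nth_Inl stack_nth_Inr
        UNIV_Plus_UNIV[symmetric] sum.Plus del: UNIV_Plus_UNIV)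
  also have "\<dots> = (mat 1 *v x) $ i"
    by (simp add: matrix_vector_mult_def)
  finally show "(sel_E *v stack x y) $ i = x $ i"
    by simp
qed

text \<open>Only the largest absolute value in the box matters, so one radius \<open>c\<close>
  covers both the symmetric boxes and the one-sided ones that end at 0.\<close>

lemma norm_power2_le_in_box:
  fixes x :: "real^'n"
  assumes "in_box l u x" "- c \<le> l" "u \<le> c"
  shows "(norm x)\<^sup>2 \<le> real CARD('n) * c\<^sup>2"
proof -
  have "(x $ j)\<^sup>2 \<le> c\<^sup>2" for j
  proof (rule abs_le_square_iff[THEN iffD1])
    have "l \<le> x $ j" "x $ j \<le> u"
      using assms(1) by (simp_all add: in_box_def)
    then show "\<bar>x $ j\<bar> \<le> \<bar>c\<bar>"
      using assms(2,3) by linarith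
  qed
  then have "(\<Sum>j\<in>UNIV. (x $ j)\<^sup>2) \<le> real CARD('n) * c\<^sup>2"
    by (intro sum_bounded_above)
  then show ?thesis
    by (simp add: norm_vec_def L2_set_def sum_nonneg)
qed

text \<open>Source of the constant: \<open>n c^2 + n (n c)^2 = c^2 n (1 + n^2)\<close>. The
  hypothesis is on the sum of the squares, so either block may be the larger one.\<close>

lemma norm_stack_le_round_off:
  fixes x y :: "real^'n"
  assumes "(norm x)\<^sup>2 + (norm y)\<^sup>2 \<le> real CARD('n) * c\<^sup>2 + real CARD('n) * (real CARD('n) * c)\<^sup>2"
    and "0 \<le> c"
  shows "norm (stack x y) \<le> c * sqrt (real CARD('n) * (1 + (real CARD('n))\<^sup>2))"
proof -
  have "norm (stack x y) \<le> sqrt (c\<^sup>2 * (real CARD('n) * (1 + (real CARD('n))\<^sup>2)))"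
    unfolding norm_stack
    by (rule real_sqrt_le_mono, rule order_trans[OF assms(1)])
      (simp add: algebra_simps power_mult_distrib)
  also have "\<dots> = c * sqrt (real CARD('n) * (1 + (real CARD('n))\<^sup>2))"
    using assms(2) by (simp only: real_sqrt_mult real_sqrt_unique)
  finally show ?thesis .
qed

lemma affine_recurrence_solution:
  fixes A :: "real^'n^'n" and B :: "real^'m^'n"
  assumes "\<And>k. k < i \<Longrightarrow> \<xi> (Suc k) = A *v \<xi> k + B *v \<upsilon> k"
  shows "\<xi> i = mat_power A i *v \<xi> 0 + (\<Sum>k<i. (mat_power A (i - 1 - k) ** B) *v \<upsilon> k)"
  using assms
proof (induction i)
  case 0
  then show ?case by simp
next
  case (Suc i)
  \<comment> \<open>Subtraction on naturals truncates, so raising the exponent by one relies on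
    \<open>k < i\<close>.\<close>
  have shift: "A ** (mat_power A (i - 1 - k) ** B) = mat_power A (i - k) ** B" if "k < i" for k
  proof -
    have "i - k = Suc (i - 1 - k)" using that by simp
    then show ?thesis by (simp add: matrix_mul_assoc)
  qed
  have "\<xi> (Suc i) = A *v \<xi> i + B *v \<upsilon> i"
    using Suc.prems by simp
  also have "\<xi> i = mat_power A i *v \<xi> 0 + (\<Sum>k<i. (mat_power A (i - 1 - k) ** B) *v \<upsilon> k)"
    using Suc by simp
  also have "A *v \<dots> = mat_power A (Suc i) *v \<xi> 0 + (\<Sum>k<i. (mat_power A (i - k) ** B) *v \<upsilon> k)"
    by (simp add: matrix_vector_right_distrib matrix_vector_mul_assoc
        linear_sum[OF matrix_vector_mul_linear] shift[simplified])
  \<comment> \<open>The new summand \<open>k = i\<close> has exponent 0, hence is exactly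
    \<open>B *v \<upsilon> i\<close>.\<close>
  finally show ?case by (simp add: add.assoc)
qed

text \<open>\<open>C\<close> is multiplied into each matrix before norms are taken, so the bound
  involves the norms of the products \<open>C A^k B\<close> and not the generally larger products of
  norms.\<close>

lemma affine_recurrence_output_bound:
  fixes A :: "real^'n^'n" and B :: "real^'m^'n" and C :: "real^'n^'k"
  assumes rec: "\<And>k. k < i \<Longrightarrow> \<xi> (Suc k) = A *v \<xi> k + B *v \<upsilon> k"
    and init: "norm (\<xi> 0) \<le> r"
    and inp: "\<And>k. k < i \<Longrightarrow> norm (\<upsilon> k) \<le> s"
  shows "norm (C *v \<xi> i) \<le> induced_norm (C ** mat_power A i) * r
    + s * (\<Sum>k<i. induced_norm (C ** mat_power A (i - 1 - k) ** B))"
proof -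
  have le: "norm (M *v x) \<le> induced_norm M * t" if "norm x \<le> t"
    for M :: "real^'p^'q" and x t
    by (rule order_trans[OF norm_matrix_vector_le])
      (simp add: that mult_left_mono induced_norm_def onorm_pos_le linear_linear)
  have "C *v \<xi> i = (C ** mat_power A i) *v \<xi> 0
      + (\<Sum>k<i. (C ** mat_power A (i - 1 - k) ** B) *v \<upsilon> k)"
    by (simp add: affine_recurrence_solution[of i \<xi> A B \<upsilon>, OF rec] matrix_vector_right_distrib matrix_vector_mul_assoc matrix_mul_assoc
        linear_sum[OF matrix_vector_mul_linear])
  also have "norm \<dots> \<le> induced_norm (C ** mat_power A i) * r
      + (\<Sum>k<i. induced_norm (C ** mat_power A (i - 1 - k) ** B) * s)"
    by (intro norm_triangle_mono le init sum_norm_le) (simp add: inp)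
  finally show ?thesis by (simp add: sum_distrib_left mult.commute)
qed

theorem proposition2:
  fixes b Imax :: nat
    and zhat z nuhat nu :: "nat \<Rightarrow> real^'n::finite"
    and \<eta> :: "int \<Rightarrow> real^'n" and \<gamma> :: "nat \<Rightarrow> real^'n"
    and eps_y :: "int \<Rightarrow> real^'n" and eps_t eps_nu :: "nat \<Rightarrow> real^'n"
    and \<xi> \<upsilon> :: "nat \<Rightarrow> real^('n + 'n)"
    and A B :: "real^('n + 'n)^('n + 'n)"
    and H H_A :: "real^'n^'n" and F :: "real^'n^'m" and \<beta> \<rho> :: real
  assumes eta: "\<forall>i<Imax. \<eta> (int i) = zhat i - z i"
    and eta_init: "\<eta> (-1) = \<eta> 0"
    and dynamics: "\<forall>i. i + 1 < Imax \<longrightarrow> \<xi> (i + 1) = A *v \<xi> i + B *v \<upsilon> i"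
    and cases:
      "(fgm_parameters H \<beta> \<and>
        A = fgm_A H \<beta> \<and> B = fgm_B H \<and>
        (\<forall>i<Imax. \<xi> i = stack (\<eta> (int i)) (\<eta> (int i - 1))) \<and>
        (\<forall>i. i + 1 < Imax \<longrightarrow>
           \<upsilon> i = stack (eps_y (int i - 1)) (eps_t i) \<and>
           in_box (- (2 powr (- real b))) (2 powr (- real b)) (eps_y (int i - 1)) \<and>
           in_box (- (real CARD('n) * 2 powr (- real b))) 0 (eps_t i)))
       \<or>
       (admm_parameters H_A F \<rho> \<and>
        A = admm_A H_A F \<rho> \<and> B = admm_B \<and>
        (\<forall>i<Imax. \<gamma> i = nuhat i - nu i) \<and>
        (\<forall>i<Imax. \<xi> i = stack (\<eta> (int i)) (\<gamma> i)) \<and>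
        norm (\<gamma> 0) \<le> norm (\<eta> 0) \<and>
        (\<forall>i. i + 1 < Imax \<longrightarrow>
           \<upsilon> i = stack (eps_y (int i)) (eps_nu i) \<and>
           in_box (- (real CARD('n) * 2 powr (- real b))) 0 (eps_y (int i)) \<and>
           in_box (- (2 powr (- real b))) (2 powr (- real b)) (eps_nu i)))"
  shows "\<forall>i<Imax.
    norm (zhat i - z i) \<le>
      induced_norm ((sel_E :: real^('n + 'n)^'n) ** mat_power A i) * norm (stack (\<eta> 0) (\<eta> 0))
      + 2 powr (- real b) * sqrt (real CARD('n) * (1 + (real CARD('n))\<^sup>2))
        * (\<Sum>k<i. induced_norm ((sel_E :: real^('n + 'n)^'n) ** mat_power A (i - 1 - k) ** B))"
proof (intro allI impI)
  fix i assume i: "i < Imax"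
  define c where "c = 2 powr (- real b)"
  have c: "0 \<le> c" by (simp add: c_def)
  \<comment> \<open>For the fast gradient method the two states coincide because
    \<open>\<eta> (-1) = \<eta> 0\<close>. For ADMM the second block is \<open>\<gamma> 0\<close>,
    whose norm is at most that of \<open>\<eta> 0\<close>.\<close>
  have init: "norm (\<xi> 0) \<le> norm (stack (\<eta> 0) (\<eta> 0))"
    using cases i eta_init by (auto simp: norm_stack)
  have inp: "norm (\<upsilon> k) \<le> c * sqrt (real CARD('n) * (1 + (real CARD('n))\<^sup>2))" if "k < i" for k
  proof -
    \<comment> \<open>The inputs are described only for steps that have a successor below
      \<open>Imax\<close>; every input reaching iterate \<open>i\<close> is of this kind.\<close>
    have k: "k + 1 < Imax" using that i by simp
    from cases show ?thesis
    proof (elim disjE conjE)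
      assume "\<forall>i. i + 1 < Imax \<longrightarrow>
           \<upsilon> i = stack (eps_y (int i - 1)) (eps_t i) \<and>
           in_box (- (2 powr (- real b))) (2 powr (- real b)) (eps_y (int i - 1)) \<and>
           in_box (- (real CARD('n) * 2 powr (- real b))) 0 (eps_t i)"
      then have v: "\<upsilon> k = stack (eps_y (int k - 1)) (eps_t k)"
        and y: "in_box (- c) c (eps_y (int k - 1))"
        and t: "in_box (- (real CARD('n) * c)) 0 (eps_t k)"
        using k by (auto simp: c_def)
      have "(norm (eps_y (int k - 1)))\<^sup>2 \<le> real CARD('n) * c\<^sup>2"
        by (rule norm_power2_le_in_box[OF y]) simp_all
      moreover have "(norm (eps_t k))\<^sup>2 \<le> real CARD('n) * (real CARD('n) * c)\<^sup>2"
        by (rule norm_power2_le_in_box[OF t]) (use c in simp_all)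
      ultimately show ?thesis
        unfolding v by (intro norm_stack_le_round_off c) linarith
    next
      assume "\<forall>i. i + 1 < Imax \<longrightarrow>
           \<upsilon> i = stack (eps_y (int i)) (eps_nu i) \<and>
           in_box (- (real CARD('n) * 2 powr (- real b))) 0 (eps_y (int i)) \<and>
           in_box (- (2 powr (- real b))) (2 powr (- real b)) (eps_nu i)"
      then have v: "\<upsilon> k = stack (eps_y (int k)) (eps_nu k)"
        and y: "in_box (- (real CARD('n) * c)) 0 (eps_y (int k))"
        and t: "in_box (- c) c (eps_nu k)"
        using k by (auto simp: c_def)
      have "(norm (eps_y (int k)))\<^sup>2 \<le> real CARD('n) * (real CARD('n) * c)\<^sup>2"
        by (rule norm_power2_le_in_box[OF y]) (use c in simp_all)
      moreover have "(norm (eps_nu k))\<^sup>2 \<le> real CARD('n) * c\<^sup>2"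
        by (rule norm_power2_le_in_box[OF t]) simp_all
      ultimately show ?thesis
        unfolding v by (intro norm_stack_le_round_off c) linarith
    qed
  qed
  \<comment> \<open>In both cases the first block of the state is \<open>\<eta> (int i)\<close>,
    which \<open>E\<close> reads off.\<close>
  have out: "sel_E *v \<xi> i = zhat i - z i"
    using cases eta i by (auto simp: sel_E_stack)
  have "\<xi> (Suc k) = A *v \<xi> k + B *v \<upsilon> k" if "k < i" for k
    using dynamics that i by simp
  from affine_recurrence_output_bound[of i \<xi> A B \<upsilon>, OF this init inp, of sel_E, unfolded out]
  show "norm (zhat i - z i) \<le>
      induced_norm ((sel_E :: real^('n + 'n)^'n) ** mat_power A i) * norm (stack (\<eta> 0) (\<eta> 0))
      + 2 powr (- real b) * sqrt (real CARD('n) * (1 + (real CARD('n))\<^sup>2))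
        * (\<Sum>k<i. induced_norm ((sel_E :: real^('n + 'n)^'n) ** mat_power A (i - 1 - k) ** B))"
    by (simp add: c_def)
qed

end
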